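(* Let $\Omega\subset\mathbb{X}$ be closed, let $r\in\{1,\ldots,n\}$ be such that $\Gamma_r:=\{X\in\Omega\,|\,\mathrm{rank}(X)\le r\}$ is nonempty, and let $f:\mathbb{X}\to(-\infty,+\infty]$ be bounded from below, coercive on $\Omega$ and locally Lipschitz continuous on $\Omega$. If the family of problems (indexed by $\rho>0$) $$\min_{X\in\Omega}\big\{f(X)+\rho\big[\|X\|_*-\|X\|_{(r)}\big]\big\}$$ is a global exact penalty for the problem $$\min_{X\in\Omega}\big\{f(X)\ \ \text{s.t.}\ \ \mathrm{rank}(X)\le r\big\},$$ then for any $p\in(0,1)$ the family of problems $$\min_{X\in\Omega}\Big\{f(X)+\rho\sum_{i=r+1}^n[\sigma_i(X)]^p\Big\}$$ is also a global exact penalty for the same rank constrained problem.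
   Context: $\mathbb{X}$ denotes either $\mathbb{R}^{n\times m}$ (with $n\le m$) or the space $\mathbb{S}^n$ of $n\times n$ real symmetric matrices, equipped with the trace inner product and the Frobenius norm. $\sigma_1(X)\ge\cdots\ge\sigma_n(X)$ are the singular values of $X$; $\|X\|_*=\sum_{i=1}^n\sigma_i(X)$ is the nuclear norm and $\|X\|_{(r)}=\sum_{i=1}^r\sigma_i(X)$ is the Ky-Fan $r$-norm. A family of penalized problems indexed by $\rho>0$ is called a global exact penalty for a problem if there exists a threshold $\overline{\rho}>0$ such that for every $\rho\ge\overline{\rho}$ the penalized problem associated to $\rho$ has the same global optimal solution set as the original problem. $f$ coercive on $\Omega$ means $f(X)\to+\infty$ as $\|X\|_F\to\infty$ with $X\in\Omega$. $f$ locally Lipschitz continuous on $\Omega$ means $f$ is finite on $\Omega$ and each point of $\Omega$ has a neighborhood $N$ such that $f$ is Lipschitz on $N\cap\Omega$. *)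

theory Defs
  imports "HOL-Analysis.Analysis" "HOL-Computational_Algebra.Polynomial"
begin

text \<open>
  An \<open>n \<times> m\<close> real matrix has type \<^typ>\<open>real ^ 'm ^ 'n\<close>. On this type the library's inner product and
  norm are the trace inner product and the Frobenius norm.
\<close>

definition symmetric_matrices :: "(real ^ 'n ^ 'n) set"
  where "symmetric_matrices = {X. transpose X = X}"

definition char_polynomial :: "real ^ 'n ^ 'n \<Rightarrow> real poly"
  where "char_polynomial A = det (mat [:0, 1:] - map_matrix (\<lambda>a. [:a:]) A)"

text \<open>
  The real eigenvalues with multiplicity, in nonincreasing order. For a symmetric matrix all
  roots of the characteristic polynomial are real, so the list has length \<^term>\<open>CARD('n)\<close>.
\<close>
definition eigenvalue_list :: "real ^ 'n ^ 'n \<Rightarrow> real list"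
  where "eigenvalue_list A = rev (sorted_list_of_multiset (proots (char_polynomial A)))"

text \<open>
  Indexed from 1 and meaningful for \<open>1 \<le> i \<le> CARD('n)\<close>: there are \<open>n\<close> singular values, the
  square roots of the eigenvalues of \<open>X X\<^sup>T\<close>, where \<open>n \<le> m\<close> is understood.
\<close>
definition singular_value :: "nat \<Rightarrow> real ^ 'm ^ 'n \<Rightarrow> real"
  where "singular_value i X = sqrt (eigenvalue_list (X ** transpose X) ! (i - 1))"

definition ky_fan_norm :: "nat \<Rightarrow> real ^ 'm ^ 'n \<Rightarrow> real"
  where "ky_fan_norm r X = (\<Sum>i = 1..r. singular_value i X)"

definition nuclear_norm :: "real ^ 'm ^ 'n \<Rightarrow> real"
  where "nuclear_norm X = (\<Sum>i = 1..CARD('n). singular_value i X)"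

definition bounded_below_on :: "'a set \<Rightarrow> ('a \<Rightarrow> ereal) \<Rightarrow> bool"
  where "bounded_below_on S f \<longleftrightarrow> (\<exists>c::real. \<forall>X\<in>S. ereal c \<le> f X)"

definition coercive_on :: "'a::real_normed_vector set \<Rightarrow> ('a \<Rightarrow> ereal) \<Rightarrow> bool"
  where "coercive_on S f \<longleftrightarrow> (f \<longlongrightarrow> \<infinity>) (inf at_infinity (principal S))"

definition locally_lipschitz_on :: "'a::metric_space set \<Rightarrow> ('a \<Rightarrow> ereal) \<Rightarrow> bool"
  where "locally_lipschitz_on S f \<longleftrightarrow>
    (\<forall>X\<in>S. \<bar>f X\<bar> \<noteq> \<infinity>) \<and>
    (\<forall>X\<in>S. \<exists>N L. open N \<and> X \<in> N \<and> L-lipschitz_on (N \<inter> S) (\<lambda>Y. real_of_ereal (f Y)))"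

definition global_solutions :: "('a \<Rightarrow> ereal) \<Rightarrow> 'a set \<Rightarrow> 'a set"
  where "global_solutions g C = {X. is_arg_min g (\<lambda>Y. Y \<in> C) X}"

text \<open>
  The penalized problems minimize \<open>F \<rho>\<close> over \<open>S\<close>; the original problem minimizes \<open>f\<close> over \<open>C\<close>.
\<close>
definition global_exact_penalty ::
    "(real \<Rightarrow> 'a \<Rightarrow> ereal) \<Rightarrow> 'a set \<Rightarrow> ('a \<Rightarrow> ereal) \<Rightarrow> 'a set \<Rightarrow> bool"
  where "global_exact_penalty F S f C \<longleftrightarrow>
    (\<exists>\<rho>\<^sub>0>0. \<forall>\<rho>\<ge>\<rho>\<^sub>0. global_solutions (F \<rho>) S = global_solutions f C)"

definition rank_feasible :: "(real ^ 'm ^ 'n) set \<Rightarrow> nat \<Rightarrow> (real ^ 'm ^ 'n) set"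
  where "rank_feasible \<Omega> r = {X \<in> \<Omega>. rank X \<le> r}"

end

theory Submission
  imports Defs
begin

text \<open>
  Write \<open>T X = \<parallel>X\<parallel>\<^sub>* - \<parallel>X\<parallel>\<^sub>(\<^sub>r\<^sub>) = \<Sum>\<^sub>i\<^sub>>\<^sub>r \<sigma>\<^sub>i X\<close> for the exact penalty that is given and
  \<open>P X = \<Sum>\<^sub>i\<^sub>>\<^sub>r (\<sigma>\<^sub>i X)\<^sup>p\<close> for the new one. Both vanish when \<open>rank X \<le> r\<close>. A number \<open>s\<close> in \<open>[0, 1]\<close>
  satisfies \<open>s \<le> s\<^sup>p\<close> and a number above 1 satisfies \<open>s\<^sup>p > 1\<close>, so at every matrix either
  \<open>T X \<le> P X\<close> or \<open>P X \<ge> 1\<close> (\<open>sum_le_sum_powr\<close>). Let \<open>v\<close> be the optimal value of the rank constrained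
  problem and \<open>c\<close> a lower bound of \<open>f\<close> on \<open>\<Omega>\<close>. For \<open>\<rho>\<close> above the threshold for \<open>T\<close> and above
  \<open>v - c + 1\<close>, the first alternative gives \<open>f X + \<rho> P X \<ge> f X + \<rho> T X \<ge> v\<close>, where equality forces
  \<open>X\<close> to minimize the problem penalized by \<open>T\<close>, hence to solve the constrained problem; the second
  gives \<open>f X + \<rho> P X \<ge> c + \<rho> > v\<close>. So both penalized problems have the same solutions
  (\<open>global_exact_penalty_dominate\<close>).

  The optimal value \<open>v\<close> has to be attained, which follows from coercivity and continuity because the
  set of matrices of rank at most \<open>r\<close> is closed (\<open>closed_rank_le\<close>, \<open>coercive_minimizer_exists\<close>).

  The remaining work connects \<open>\<sigma>\<^sub>i\<close>, which is an entry of the sorted list of roots of the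
  characteristic polynomial of \<open>X X\<^sup>T\<close>, to the rank: one must know that this list has \<open>n\<close>
  entries, that they are nonnegative, and that at most \<open>rank X\<close> of them are nonzero. All three
  are read off from an orthogonal diagonalization of \<open>X X\<^sup>T\<close>, so the spectral theorem for symmetric
  real matrices comes first.
\<close>

section \<open>The spectral theorem for symmetric real matrices\<close>

text \<open>
  A maximizer \<open>v\<close> of the Rayleigh quotient on the unit sphere of \<open>U\<close> is an eigenvector: the quadratic
  form \<open>c (x \<bullet> x) - f x \<bullet> x\<close> is nonnegative on \<open>U\<close> and vanishes at \<open>v\<close>, so its derivative at \<open>v\<close>
  vanishes in every direction of \<open>U\<close>. The direction \<open>c v - f v\<close> is the one to test, since along it
  the derivative is twice its squared norm.
\<close>
lemma selfadjoint_eigenvector_in_invariant_subspace: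
  fixes f :: "'a::euclidean_space \<Rightarrow> 'a"
  assumes f: "linear f" and sa: "\<And>x y. f x \<bullet> y = x \<bullet> f y"
    and U: "subspace U" "f ` U \<subseteq> U" "U \<noteq> {0}"
  obtains v c where "v \<in> U" "norm v = 1" "f v = c *\<^sub>R v"
proof -
  interpret linear f by fact
  let ?S = "U \<inter> sphere 0 1"
  have compact: "compact ?S"
    by (intro closed_Int_compact closed_subspace U) simp
  obtain u where u: "u \<in> U" "u \<noteq> 0"
    using U subspace_0 by blast
  have "(1 / norm u) *\<^sub>R u \<in> ?S"
    using u U(1) by (auto intro: subspace_scale)
  then have nonempty: "?S \<noteq> {}"
    by blast
  have cont: "continuous_on ?S (\<lambda>x. f x \<bullet> x)"
    by (intro continuous_intros linear_continuous_on) (simp add: f linear_linear)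
  obtain v where v: "v \<in> U" "norm v = 1" and vmax: "\<And>x. x \<in> ?S \<Longrightarrow> f x \<bullet> x \<le> f v \<bullet> v"
    using continuous_attains_sup[OF compact nonempty cont] by auto
  define c where "c = f v \<bullet> v"
  have vv: "v \<bullet> v = 1"
    using v by (simp add: norm_eq_1)
  have nonneg: "0 \<le> c * (x \<bullet> x) - f x \<bullet> x" if "x \<in> U" for x
  proof (cases "x = 0")
    case False
    let ?y = "(1 / norm x) *\<^sub>R x"
    have "?y \<in> ?S"
      using that False U(1) by (auto intro: subspace_scale)
    from vmax[OF this] have "(f x \<bullet> x) / (x \<bullet> x) \<le> c"
      by (simp add: c_def scale power2_norm_eq_inner[symmetric] power2_eq_square)
    with False show ?thesis
      by (simp add: divide_simps)
  qed (simp add: zero)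
  define w where "w = c *\<^sub>R v - f v"
  have w: "w \<in> U"
    unfolding w_def using U v by (intro subspace_diff subspace_scale) auto
  define g where "g = c * (w \<bullet> w) - f w \<bullet> w"
  have g: "0 \<le> g"
    unfolding g_def by (rule nonneg[OF w])
  have quad: "0 \<le> 2 * t * (w \<bullet> w) + t\<^sup>2 * g" for t
  proof -
    have "v + t *\<^sub>R w \<in> U"
      using U(1) v w by (intro subspace_add subspace_scale)
    moreover have "f w \<bullet> v = f v \<bullet> w"
      using sa[of w v] by (simp add: inner_commute)
    moreover have "c * ((v + t *\<^sub>R w) \<bullet> (v + t *\<^sub>R w)) - f (v + t *\<^sub>R w) \<bullet> (v + t *\<^sub>R w)
        = 2 * t * (c * (v \<bullet> w) - f v \<bullet> w) + t\<^sup>2 * g"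
      using vv \<open>f w \<bullet> v = f v \<bullet> w\<close> c_def
      by (simp add: g_def add scale inner_add_left inner_add_right inner_commute[of w v]
          power2_eq_square algebra_simps)
    moreover have "w \<bullet> w = c * (v \<bullet> w) - f v \<bullet> w"
      by (subst (1) w_def) (simp add: inner_diff_left)
    ultimately show ?thesis
      using nonneg[of "v + t *\<^sub>R w"] by simp
  qed
  have "w \<bullet> w = 0"
  proof (rule ccontr)
    assume "w \<bullet> w \<noteq> 0"
    then have pos: "0 < w \<bullet> w" by simp
    \<comment> \<open>At this \<open>t\<close> the quadratic in \<open>quad\<close> is negative; the summand 1 only avoids a division by zero.\<close>
    define t where "t = - (w \<bullet> w) / (g + 1)"
    have ww: "w \<bullet> w = - t * (g + 1)" and "t \<noteq> 0"
      using g pos by (auto simp: t_def)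
    have "2 * t * (w \<bullet> w) + t\<^sup>2 * g = - (t\<^sup>2 * (g + 2))"
      unfolding ww by (simp add: power2_eq_square algebra_simps)
    also have "\<dots> < 0"
      using \<open>t \<noteq> 0\<close> g by simp
    finally show False
      using quad[of t] by simp
  qed
  then have "f v = c *\<^sub>R v"
    by (simp add: w_def)
  with v show thesis
    using that by blast
qed

text \<open>
  Induction on the dimension: the orthogonal complement, within \<open>U\<close>, of an eigenvector is again
  invariant because \<open>f\<close> is self-adjoint.
\<close>
lemma selfadjoint_orthonormal_eigenbasis:
  fixes f :: "'a::euclidean_space \<Rightarrow> 'a"
  assumes f: "linear f" and sa: "\<And>x y. f x \<bullet> y = x \<bullet> f y"
  shows "subspace U \<Longrightarrow> f ` U \<subseteq> U \<Longrightarrow>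
    \<exists>B\<subseteq>U. pairwise orthogonal B \<and> finite B \<and> card B = dim U \<and> (\<forall>b\<in>B. norm b = 1 \<and> (\<exists>c. f b = c *\<^sub>R b))"
proof (induction "dim U" arbitrary: U)
  case 0
  then show ?case
    by (intro exI[of _ "{}"]) (auto simp: pairwise_def)
next
  case (Suc n)
  then have "U \<noteq> {0}"
    by (auto simp: dim_eq_0)
  then obtain v c where v: "v \<in> U" "norm v = 1" "f v = c *\<^sub>R v"
    using selfadjoint_eigenvector_in_invariant_subspace[OF f sa Suc.prems] by blast
  define W where "W = {y \<in> U. \<forall>x \<in> span {v}. orthogonal x y}"
  have W: "W = {y \<in> U. v \<bullet> y = 0}"
    by (auto simp: W_def span_singleton orthogonal_def)
  have "span {v} \<subseteq> U"
    using Suc.prems v by (simp add: span_minimal)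
  then have "dim W + dim (span {v}) = dim U"
    unfolding W_def using Suc.prems by (intro dim_subspace_orthogonal_to_vectors) auto
  moreover have "dim (span {v}) = 1"
    using v by (auto simp: dim_singleton)
  ultimately have dim: "n = dim W"
    using Suc.hyps(2) by simp
  have sub: "subspace W"
    using Suc.prems(1) unfolding W subspace_def by (auto simp: inner_add_right)
  have "v \<bullet> f y = 0" if "v \<bullet> y = 0" for y
    using that v(3) sa[of v y] by simp
  then have inv: "f ` W \<subseteq> W"
    using Suc.prems(2) by (auto simp: W)
  obtain B where B: "B \<subseteq> W" "pairwise orthogonal B" "finite B" "card B = dim W"
      "\<forall>b\<in>B. norm b = 1 \<and> (\<exists>c. f b = c *\<^sub>R b)"
    using Suc.hyps(1)[OF dim sub inv] by blast
  have "v \<notin> B"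
    using B(1) v(2) by (auto simp: W norm_eq_1)
  then have "card (insert v B) = dim U"
    using B dim Suc.hyps(2) by simp
  moreover have "pairwise orthogonal (insert v B)"
    using B(1,2) by (auto simp: pairwise_insert W orthogonal_def inner_commute)
  ultimately show ?case
    using B v by (intro exI[of _ "insert v B"]) (auto simp: W)
qed

definition diagonal_matrix :: "('n \<Rightarrow> 'a::zero) \<Rightarrow> 'a ^ 'n ^ 'n"
  where "diagonal_matrix d = (\<chi> i j. if i = j then d i else 0)"

lemma matrix_mult_diagonal_component:
  fixes Q :: "'a::semiring_1 ^ 'n ^ 'm"
  shows "(Q ** diagonal_matrix d) $ i $ j = Q $ i $ j * d j"
  by (simp add: matrix_matrix_mult_def diagonal_matrix_def if_distrib cong: if_cong)

theorem symmetric_matrix_diagonalization: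
  fixes A :: "real ^ 'n ^ 'n"
  assumes A: "transpose A = A"
  obtains Q d where "orthogonal_matrix Q" "A ** Q = Q ** diagonal_matrix d"
proof -
  have sa: "(A *v x) \<bullet> y = x \<bullet> (A *v y)" for x y
    by (metis A dot_lmul_matrix matrix_vector_mul transpose_matrix_vector)
  obtain B where B: "pairwise orthogonal B" "finite B" "card B = CARD('n)"
      "\<And>b. b \<in> B \<Longrightarrow> norm b = 1 \<and> (\<exists>c. A *v b = c *\<^sub>R b)"
    using selfadjoint_orthonormal_eigenbasis[of "(*v) A" UNIV] sa
    by (auto simp: dim_UNIV)
  obtain h where h: "bij_betw h (UNIV :: 'n set) B"
    using B(2,3) finite_same_card_bij[of "UNIV :: 'n set" B] by auto
  then have hB: "h i \<in> B" for i
    by (auto simp: bij_betw_def)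
  obtain d where d: "\<And>b. b \<in> B \<Longrightarrow> A *v b = d b *\<^sub>R b"
    using B(4) by metis
  define Q where "Q = (\<chi> i j. h j $ i)"
  have col: "column j Q = h j" for j
    by (simp add: Q_def column_def vec_eq_iff)
  have "orthogonal (h i) (h j)" if "i \<noteq> j" for i j
    using pairwiseD[OF B(1) hB hB] bij_betw_imp_inj_on[OF h] that by (simp add: inj_eq)
  then have "orthogonal_matrix Q"
    using B(4) hB by (auto simp: orthogonal_matrix_orthonormal_columns col)
  moreover have "A ** Q = Q ** diagonal_matrix (\<lambda>i. d (h i))"
  proof -
    have "(A ** Q) $ i $ j = (Q ** diagonal_matrix (\<lambda>i. d (h i))) $ i $ j" for i j
    proof -
      have "(A ** Q) $ i $ j = (A *v h j) $ i"
        by (simp add: matrix_matrix_mult_def matrix_vector_mult_def Q_def)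
      also have "\<dots> = d (h j) * h j $ i"
        by (simp add: d hB)
      finally show ?thesis
        by (simp add: matrix_mult_diagonal_component Q_def)
    qed
    then show ?thesis by (simp add: vec_eq_iff)
  qed
  ultimately show thesis by (rule that)
qed

section \<open>Eigenvalue lists\<close>

lemma map_matrix_const_poly_mult:
  fixes A :: "'a::comm_semiring_1 ^ 'm ^ 'n" and B :: "'a ^ 'k ^ 'm"
  shows "map_matrix (\<lambda>a. [:a:]) (A ** B) = map_matrix (\<lambda>a. [:a:]) A ** map_matrix (\<lambda>a. [:a:]) B"
  by (simp add: vec_eq_iff matrix_matrix_mult_def sum_to_poly[symmetric] mult.commute)

lemma mat_mult_commute:
  fixes A :: "'a::comm_semiring_1 ^ 'n ^ 'n"
  shows "mat c ** A = A ** mat c"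
  by (simp add: vec_eq_iff matrix_matrix_mult_def mat_def if_distrib if_distribR mult.commute cong: if_cong)

lemma matrix_diff_mult_distrib:
  fixes A B :: "'a::ring_1 ^ 'm ^ 'n"
  shows "(A - B) ** C = A ** C - B ** C"
  by (simp add: vec_eq_iff matrix_matrix_mult_def left_diff_distrib sum_subtractf)

lemma matrix_mult_diff_distrib:
  fixes B C :: "'a::ring_1 ^ 'm ^ 'n"
  shows "A ** (B - C) = A ** B - A ** C"
  by (simp add: vec_eq_iff matrix_matrix_mult_def right_diff_distrib sum_subtractf)

text \<open>
  The usual argument over the polynomial ring: \<open>Q\<close>, read as a matrix of constant polynomials,
  intertwines \<open>x I - A\<close> with \<open>x I - D\<close>, and its determinant is a unit because \<open>Q\<close> has an inverse
  with constant entries.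
\<close>
lemma char_polynomial_similar:
  fixes A D :: "real ^ 'n ^ 'n"
  assumes "Q ** P = mat 1" and AQ: "A ** Q = Q ** D"
  shows "char_polynomial A = char_polynomial D"
proof -
  let ?C = "map_matrix (\<lambda>a. [:a:]) :: real ^ 'n ^ 'n \<Rightarrow> real poly ^ 'n ^ 'n"
  let ?x = "mat [:0, 1:] :: real poly ^ 'n ^ 'n"
  have "?C Q ** ?C P = mat 1"
    using assms(1) by (simp add: map_matrix_const_poly_mult[symmetric] vec_eq_iff mat_def one_pCons)
  then have "det (?C Q) * det (?C P) = 1"
    by (metis det_I det_mul)
  then have nz: "det (?C Q) \<noteq> 0" by auto
  have "(?x - ?C A) ** ?C Q = ?C Q ** (?x - ?C D)"
    using arg_cong[OF AQ, of ?C]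
    by (simp add: matrix_diff_mult_distrib matrix_mult_diff_distrib mat_mult_commute map_matrix_const_poly_mult)
  then have "det (?x - ?C A) * det (?C Q) = det (?C Q) * det (?x - ?C D)"
    by (metis det_mul)
  with nz show ?thesis
    by (simp add: char_polynomial_def)
qed

lemma proots_char_polynomial_diagonal:
  fixes d :: "'n::finite \<Rightarrow> real"
  shows "proots (char_polynomial (diagonal_matrix d)) = image_mset d (mset_set UNIV)"
proof -
  have "char_polynomial (diagonal_matrix d) = (\<Prod>i\<in>UNIV. [:- d i, 1:])"
    unfolding char_polynomial_def
    by (subst det_diagonal) (auto simp: diagonal_matrix_def mat_def)
  then show ?thesis
    by (simp add: proots_prod sum_unfold_sum_mset)
qed

text \<open>The unit vectors at the nonzero diagonal entries lie in the range of the matrix.\<close>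
lemma card_nonzero_le_rank_diagonal:
  fixes d :: "'n::finite \<Rightarrow> real"
  shows "card {i. d i \<noteq> 0} \<le> rank (diagonal_matrix d)"
proof -
  let ?D = "diagonal_matrix d" and ?B = "(\<lambda>i. axis i 1) ` {i. d i \<noteq> 0} :: (real ^ 'n) set"
  have "axis i 1 \<in> range ((*v) ?D)" if "d i \<noteq> 0" for i
  proof
    have "?D *v axis i 1 = d i *\<^sub>R axis i 1"
      unfolding matrix_vector_mult_basis
      by (simp add: vec_eq_iff column_def diagonal_matrix_def axis_def)
    then show "axis i 1 = ?D *v ((1 / d i) *\<^sub>R axis i 1)"
      using that by (simp add: matrix_vector_mult_scaleR)
  qed simp
  then have "?B \<subseteq> range ((*v) ?D)"
    by blast
  moreover have "independent ?B"
    by (rule independent_mono[OF independent_Basis]) (force simp: Basis_vec_def)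
  ultimately have "card ?B \<le> rank ?D"
    by (simp add: rank_dim_range independent_card_le_dim)
  moreover have "inj (\<lambda>i. axis i (1::real) :: real ^ 'n)"
    by (simp add: inj_on_def axis_eq_axis)
  ultimately show ?thesis
    by (simp add: card_image inj_on_subset)
qed

text \<open>
  If \<open>Q\<close> diagonalizes \<open>X X\<^sup>T\<close> and \<open>M = Q\<^sup>T X\<close>, then the diagonal form of \<open>X X\<^sup>T\<close> is \<open>M M\<^sup>T\<close>. This
  single factorization shows that the eigenvalues are sums of squares and that no more than
  \<open>rank M \<le> rank X\<close> of them are nonzero.
\<close>
lemma gram_matrix_eigenvalues:
  fixes X :: "real ^ 'm ^ 'n"
  obtains d :: "'n \<Rightarrow> real"
  where "eigenvalue_list (X ** transpose X)
           = rev (sorted_list_of_multiset (image_mset d (mset_set UNIV)))"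
    and "\<And>i. 0 \<le> d i" and "card {i. d i \<noteq> 0} \<le> rank X"
proof -
  have "transpose (X ** transpose X) = X ** transpose X"
    by (simp add: matrix_transpose_mul)
  then obtain Q d where Q: "orthogonal_matrix Q"
    and XQ: "(X ** transpose X) ** Q = Q ** diagonal_matrix d"
    using symmetric_matrix_diagonalization by blast
  have QQ: "Q ** transpose Q = mat 1" "transpose Q ** Q = mat 1"
    using Q by (auto simp: orthogonal_matrix_def)
  define M where "M = transpose Q ** X"
  have "M ** transpose M = transpose Q ** ((X ** transpose X) ** Q)"
    by (simp add: M_def matrix_transpose_mul matrix_mul_assoc)
  also have "\<dots> = diagonal_matrix d"
    by (simp add: XQ QQ matrix_mul_assoc)
  finally have D: "M ** transpose M = diagonal_matrix d" .
  have "d i = (\<Sum>k\<in>UNIV. (M $ i $ k)\<^sup>2)" for i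
    using arg_cong[OF D, of "\<lambda>A. A $ i $ i"]
    by (simp add: matrix_matrix_mult_def diagonal_matrix_def transpose_def power2_eq_square)
  then have "0 \<le> d i" for i
    by (simp add: sum_nonneg)
  moreover have "rank (diagonal_matrix d) \<le> rank X"
    using rank_mul_le_left[of M "transpose M"] rank_mul_le_right[of "transpose Q" X]
    unfolding D M_def[symmetric] by (rule order_trans)
  then have "card {i. d i \<noteq> 0} \<le> rank X"
    using card_nonzero_le_rank_diagonal[of d] by linarith
  moreover have "eigenvalue_list (X ** transpose X)
      = rev (sorted_list_of_multiset (image_mset d (mset_set UNIV)))"
    by (simp add: eigenvalue_list_def char_polynomial_similar[OF QQ(1) XQ]
        proots_char_polynomial_diagonal)
  ultimately show thesis
    using that by blast
qed

section \<open>Singular values and rank\<close>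

text \<open>
  A nonzero entry at position \<open>j\<close> would make all entries at the \<open>j + 1\<close> positions up to \<open>j\<close> positive.
\<close>
lemma nth_decreasing_eq_0:
  fixes L :: "real list"
  assumes sorted: "sorted (rev L)" and nonneg: "\<And>x. x \<in> set L \<Longrightarrow> 0 \<le> x"
    and few: "length (filter (\<lambda>x. x \<noteq> 0) L) \<le> j" and j: "j < length L"
  shows "L ! j = 0"
proof (rule ccontr)
  assume "L ! j \<noteq> 0"
  then have pos: "0 < L ! j"
    using nonneg[of "L ! j"] j by simp
  have "x \<noteq> 0" if x: "x \<in> set (take (Suc j) L)" for x
  proof -
    obtain k where "k \<le> j" "x = L ! k"
      using x j by (auto simp: in_set_conv_nth less_Suc_eq_le)
    then have "L ! j \<le> x"
      using sorted_rev_nth_mono[OF sorted] j by simp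
    then show ?thesis using pos by simp
  qed
  then have "filter (\<lambda>x. x \<noteq> 0) (take (Suc j) L) = take (Suc j) L"
    by (simp add: filter_id_conv)
  then have "Suc j \<le> length (filter (\<lambda>x. x \<noteq> 0) (take (Suc j) L @ drop (Suc j) L))"
    using j by (simp only: filter_append length_append length_take)
  with few show False by simp
qed

lemma
  fixes X :: "real ^ 'm ^ 'n"
  assumes i: "i \<in> {1..CARD('n)}"
  shows singular_value_nonneg: "0 \<le> singular_value i X"
    and singular_value_eq_0: "rank X < i \<Longrightarrow> singular_value i X = 0"
proof -
  obtain d :: "'n \<Rightarrow> real" where
    L: "eigenvalue_list (X ** transpose X) = rev (sorted_list_of_multiset (image_mset d (mset_set UNIV)))"
      (is "?L = _")
    and nonneg: "\<And>i. 0 \<le> d i" and card: "card {i. d i \<noteq> 0} \<le> rank X"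
    using gram_matrix_eigenvalues[of X] by blast
  have mset: "mset ?L = image_mset d (mset_set UNIV)"
    by (simp add: L)
  have len: "length ?L = CARD('n)"
    using arg_cong[OF mset, of size] by simp
  have "set ?L = range d"
    using arg_cong[OF mset, of set_mset] by simp
  then have L_nonneg: "0 \<le> x" if "x \<in> set ?L" for x
    using that nonneg by auto
  have i': "i - 1 < length ?L"
    using i len by auto
  show "0 \<le> singular_value i X"
    unfolding singular_value_def using L_nonneg[OF nth_mem[OF i']] by simp
  have "mset (filter (\<lambda>x. x \<noteq> 0) ?L) = image_mset d (mset_set {i. d i \<noteq> 0})"
    by (simp add: mset filter_mset_image_mset filter_mset_mset_set)
  from arg_cong[OF this, of size]
  have "length (filter (\<lambda>x. x \<noteq> 0) ?L) \<le> rank X"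
    using card by (simp del: mset_filter)
  then have "?L ! (i - 1) = 0" if "rank X < i"
    using that by (intro nth_decreasing_eq_0 L_nonneg i') (auto simp: L)
  then show "singular_value i X = 0" if "rank X < i"
    using that by (simp add: singular_value_def)
qed

section \<open>Closedness of the rank constraint and existence of solutions\<close>

lemma norm_matrix_vector_mult_le:
  fixes A :: "real ^ 'm ^ 'n"
  shows "norm (A *v x) \<le> norm A * norm x"
proof -
  have "norm (A *v x) \<le> L2_set (\<lambda>i. norm (A $ i) * norm x) UNIV"
    unfolding norm_vec_def[of "A *v x"]
    by (intro L2_set_mono) (auto simp: matrix_vector_mul_component Cauchy_Schwarz_ineq2)
  also have "\<dots> = norm A * norm x"
    by (simp add: L2_set_left_distrib norm_vec_def[of A])
  finally show ?thesis .
qed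

text \<open>
  The rank cannot drop under small perturbations: \<open>A\<close> is injective on its row space \<open>U\<close>, whose
  dimension is \<open>rank A\<close>, hence \<open>e * norm x \<le> norm (A *v x)\<close> on \<open>U\<close> for some \<open>e > 0\<close>. A matrix \<open>B\<close>
  at distance less than \<open>e\<close> from \<open>A\<close> is then still injective on \<open>U\<close>.
\<close>
lemma closed_rank_le: "closed {A :: real ^ 'm ^ 'n. rank A \<le> r}"
proof -
  have "\<exists>e>0. \<forall>B. dist B A < e \<longrightarrow> r < rank B" if "r < rank A" for A :: "real ^ 'm ^ 'n"
  proof -
    let ?U = "span (rows A)"
    have inj: "x = 0" if "x \<in> ?U" "A *v x = 0" for x
    proof -
      have "row i A \<bullet> x = 0" for i
        using that(2) by (metis matrix_vector_mul_component row_def vec_lambda_eta zero_index)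
      then have "rows A \<subseteq> {y. y \<bullet> x = 0}"
        by (auto simp: rows_def)
      then have "?U \<subseteq> {y. y \<bullet> x = 0}"
        by (intro span_minimal) (auto simp: subspace_def inner_add_left)
      with that(1) show ?thesis by auto
    qed
    obtain e where e: "e > 0" "\<And>x. x \<in> ?U \<Longrightarrow> e * norm x \<le> norm (A *v x)"
      using injective_imp_isometric[of ?U "(*v) A"] inj
      by (auto simp: closed_subspace matrix_vector_mul_bounded_linear)
    have "r < rank B" if B: "dist B A < e" for B
    proof -
      have "x = 0" if x: "x \<in> ?U" "B *v x = 0" for x
      proof (rule ccontr)
        assume "x \<noteq> 0"
        have "e * norm x \<le> norm ((A - B) *v x)"
          using e(2)[OF x(1)] x(2) by (simp add: matrix_vector_mult_diff_rdistrib)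
        also have "\<dots> \<le> norm (A - B) * norm x"
          by (rule norm_matrix_vector_mult_le)
        also have "\<dots> < e * norm x"
          using B \<open>x \<noteq> 0\<close> by (simp add: dist_norm norm_minus_commute)
        finally show False by simp
      qed
      then have "inj_on ((*v) B) ?U"
        by (subst linear_injective_on_subspace_0) auto
      then have "dim ((*v) B ` ?U) = dim ?U"
        by (intro dim_image_eq) (auto simp: span_span)
      moreover have "dim ((*v) B ` ?U) \<le> rank B"
        unfolding rank_dim_range by (intro dim_subset) auto
      ultimately show ?thesis
        using \<open>r < rank A\<close> by (simp add: row_rank_def)
    qed
    with e(1) show ?thesis by blast
  qed
  then have "open {A :: real ^ 'm ^ 'n. r < rank A}"
    by (simp add: open_dist)
  then show ?thesis
    by (simp add: closed_def Compl_eq not_le)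
qed

lemma bounded_below_on_subset: "bounded_below_on S f \<Longrightarrow> T \<subseteq> S \<Longrightarrow> bounded_below_on T f"
  unfolding bounded_below_on_def by blast

lemma global_solutions_iff:
  fixes g :: "'a \<Rightarrow> ereal"
  shows "X \<in> global_solutions g C \<longleftrightarrow> X \<in> C \<and> (\<forall>Y\<in>C. g X \<le> g Y)"
  by (auto simp: global_solutions_def is_arg_min_linorder)

text \<open>
  By coercivity, only a bounded part of \<open>C\<close> competes with a given feasible point, and \<open>f\<close> is continuous
  on that compact part.
\<close>
lemma coercive_minimizer_exists:
  fixes f :: "'a::euclidean_space \<Rightarrow> ereal"
  assumes C: "closed C" "C \<noteq> {}" "C \<subseteq> S"
    and coercive: "coercive_on S f" and lip: "locally_lipschitz_on S f"
  shows "global_solutions f C \<noteq> {}"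
proof -
  define g where "g X = real_of_ereal (f X)" for X
  have f: "f X = ereal (g X)" if "X \<in> S" for X
    using lip that by (simp add: g_def locally_lipschitz_on_def ereal_real)
  have "continuous (at X within S) g" if X: "X \<in> S" for X
  proof -
    obtain N L where N: "open N" "X \<in> N" and L: "L-lipschitz_on (N \<inter> S) g"
      using lip X unfolding locally_lipschitz_on_def g_def by blast
    have "continuous (at X within N \<inter> S) g"
      using lipschitz_on_continuous_on[OF L] N(2) X
      by (simp add: continuous_on_eq_continuous_within)
    then show ?thesis
      using at_within_nhd[of X N "N \<inter> S" S] N by (auto simp: Int_ac)
  qed
  then have cont: "continuous_on S g"
    by (simp add: continuous_on_eq_continuous_within)
  obtain X0 where X0: "X0 \<in> C"
    using C(2) by blast
  have "eventually (\<lambda>X. ereal (g X0) < f X) (inf at_infinity (principal S))"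
    using coercive unfolding coercive_on_def tendsto_PInfty by blast
  then obtain b where b: "\<And>X. X \<in> S \<Longrightarrow> b \<le> norm X \<Longrightarrow> g X0 < g X"
    unfolding eventually_inf_principal eventually_at_infinity using f by (metis less_ereal.simps(1))
  let ?K = "C \<inter> cball 0 b"
  have X0K: "X0 \<in> ?K"
    using b[of X0] X0 C(3) by (force simp: not_le)
  then have "?K \<noteq> {}"
    by blast
  moreover have "compact ?K"
    by (intro closed_Int_compact C) simp
  moreover have "continuous_on ?K g"
    using cont C(3) by (auto intro: continuous_on_subset)
  ultimately have "\<exists>Z\<in>?K. \<forall>Y\<in>?K. g Z \<le> g Y"
    by (intro continuous_attains_inf)
  then obtain Z where Z: "Z \<in> ?K" "\<And>Y. Y \<in> ?K \<Longrightarrow> g Z \<le> g Y"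
    by blast
  have "g Z \<le> g Y" if Y: "Y \<in> C" for Y
  proof (cases "norm Y \<le> b")
    case True
    with Y Z(2) show ?thesis by simp
  next
    case False
    then have "g X0 < g Y"
      using b[of Y] Y C(3) by auto
    with Z(2)[OF X0K] show ?thesis by simp
  qed
  then have "Z \<in> global_solutions f C"
    using Z(1) C(3) by (auto simp: global_solutions_iff f subset_iff)
  then show ?thesis by blast
qed

section \<open>Comparing penalties\<close>

text \<open>
  A penalty \<open>P\<close> inherits exactness from \<open>T\<close> although it dominates \<open>T\<close> only where \<open>P < 1\<close>: elsewhere
  \<open>\<rho> P \<ge> \<rho>\<close> already lifts the objective above the optimal value, because \<open>f\<close> is bounded below.
\<close>
lemma global_exact_penalty_dominate:
  fixes f :: "'a \<Rightarrow> ereal" and T P :: "'a \<Rightarrow> real"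
  assumes "C \<subseteq> S" and sol: "global_solutions f C \<noteq> {}"
    and finite: "\<And>X. X \<in> S \<Longrightarrow> \<bar>f X\<bar> \<noteq> \<infinity>"
    and bounded: "bounded_below_on S f"
    and zero: "\<And>X. X \<in> C \<Longrightarrow> T X = 0" "\<And>X. X \<in> C \<Longrightarrow> P X = 0"
    and dominate: "\<And>X. X \<in> S \<Longrightarrow> T X \<le> P X \<or> 1 \<le> P X"
    and exact: "global_exact_penalty (\<lambda>\<rho> X. f X + ereal (\<rho> * T X)) S f C"
  shows "global_exact_penalty (\<lambda>\<rho> X. f X + ereal (\<rho> * P X)) S f C"
proof -
  define g where "g X = real_of_ereal (f X)" for X
  have f: "f X = ereal (g X)" if "X \<in> S" for X
    using finite[OF that] by (simp add: g_def ereal_real)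
  obtain c where c: "\<And>X. X \<in> S \<Longrightarrow> c \<le> g X"
    using bounded f unfolding bounded_below_on_def by fastforce
  obtain Z where Z: "Z \<in> global_solutions f C"
    using sol by blast
  then have ZC: "Z \<in> C" and ZS: "Z \<in> S"
    using \<open>C \<subseteq> S\<close> by (auto simp: global_solutions_iff)
  have opt_iff: "X \<in> global_solutions f C \<longleftrightarrow> X \<in> C \<and> g X = g Z" for X
    using Z \<open>C \<subseteq> S\<close> f by (fastforce simp: global_solutions_iff subset_iff)
  obtain \<rho>\<^sub>0 where \<rho>\<^sub>0: "0 < \<rho>\<^sub>0" and
    T_exact: "\<And>\<rho>. \<rho>\<^sub>0 \<le> \<rho> \<Longrightarrow> global_solutions (\<lambda>X. f X + ereal (\<rho> * T X)) S = global_solutions f C"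
    using exact unfolding global_exact_penalty_def by blast
  \<comment> \<open>The second bound makes \<open>c + \<rho>\<close> exceed the optimal value \<open>g Z\<close>.\<close>
  have "global_solutions (\<lambda>X. f X + ereal (\<rho> * P X)) S = global_solutions f C"
    if \<rho>: "max \<rho>\<^sub>0 (g Z - c + 1) \<le> \<rho>" for \<rho>
  proof -
    have pos: "0 < \<rho>"
      using \<rho> \<rho>\<^sub>0 by simp
    have T_lower: "g Z \<le> g X + \<rho> * T X" if "X \<in> S" for X
    proof -
      have "Z \<in> global_solutions (\<lambda>X. f X + ereal (\<rho> * T X)) S"
        using Z T_exact[of \<rho>] \<rho> by simp
      then show ?thesis
        using that f ZS zero(1)[OF ZC] by (auto simp: global_solutions_iff)
    qed
    have P_lower: "g Z \<le> g X + \<rho> * P X" and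
      P_eq: "g X + \<rho> * P X \<le> g Z \<Longrightarrow> X \<in> global_solutions f C" if X: "X \<in> S" for X
    proof -
      have "g Z < g X + \<rho> * P X \<or> T X \<le> P X"
      proof (cases "1 \<le> P X")
        case True
        then have "\<rho> \<le> \<rho> * P X"
          using pos by simp
        then show ?thesis
          using c[OF X] \<rho> by simp
      qed (use dominate[OF X] in blast)
      then have *: "g Z < g X + \<rho> * P X \<or> g X + \<rho> * T X \<le> g X + \<rho> * P X"
        using pos by auto
      then show "g Z \<le> g X + \<rho> * P X"
        using T_lower[OF X] by auto
      assume "g X + \<rho> * P X \<le> g Z"
      with * have "g X + \<rho> * T X \<le> g Z"
        by auto
      then have "g X + \<rho> * T X \<le> g Y + \<rho> * T Y" if "Y \<in> S" for Y
        using T_lower[OF that] by linarith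
      then have "X \<in> global_solutions (\<lambda>X. f X + ereal (\<rho> * T X)) S"
        using X f by (simp add: global_solutions_iff)
      then show "X \<in> global_solutions f C"
        using T_exact[of \<rho>] \<rho> by simp
    qed
    show ?thesis
    proof (intro set_eqI iffI)
      fix X assume X: "X \<in> global_solutions (\<lambda>X. f X + ereal (\<rho> * P X)) S"
      then have "X \<in> S"
        by (simp add: global_solutions_iff)
      moreover from X this have "g X + \<rho> * P X \<le> g Z"
        using ZS f zero(2)[OF ZC] by (auto simp: global_solutions_iff)
      ultimately show "X \<in> global_solutions f C"
        by (rule P_eq)
    next
      fix X assume "X \<in> global_solutions f C"
      then have X: "X \<in> C" "g X = g Z"
        by (auto simp: opt_iff)
      then show "X \<in> global_solutions (\<lambda>X. f X + ereal (\<rho> * P X)) S"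
        using P_lower f zero(2) \<open>C \<subseteq> S\<close> by (auto simp: global_solutions_iff subset_iff)
    qed
  qed
  moreover have "0 < max \<rho>\<^sub>0 (g Z - c + 1)"
    using \<rho>\<^sub>0 by simp
  ultimately show ?thesis
    unfolding global_exact_penalty_def by blast
qed

text \<open>
  For \<open>p < 1\<close> the map \<open>s \<mapsto> s\<^sup>p\<close> lies above the identity on \<open>[0, 1]\<close>, and a single term with \<open>s > 1\<close>
  pushes the sum of powers above 1.
\<close>
lemma sum_le_sum_powr:
  fixes s :: "'a \<Rightarrow> real"
  assumes I: "finite I" and nonneg: "\<And>i. i \<in> I \<Longrightarrow> 0 \<le> s i" and p: "0 < p" "p < 1"
  shows "sum s I \<le> (\<Sum>i\<in>I. s i powr p) \<or> 1 \<le> (\<Sum>i\<in>I. s i powr p)"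
proof (cases "\<forall>i\<in>I. s i \<le> 1")
  case True
  have "s i \<le> s i powr p" if "i \<in> I" for i
    using powr_mono'[of p 1 "s i"] nonneg[OF that] True that p by simp
  then show ?thesis
    by (simp add: sum_mono)
next
  case False
  then obtain j where j: "j \<in> I" "1 < s j"
    by auto
  have "1 \<le> s j powr p"
    using j p by (simp add: ge_one_powr_ge_zero)
  also have "\<dots> \<le> (\<Sum>i\<in>I. s i powr p)"
    using j I by (intro member_le_sum) auto
  finally show ?thesis by blast
qed

text \<open>
  Rectangular and symmetric matrices are treated together: the symmetric case is the instance
  \<open>'m = 'n\<close> with \<open>\<Omega>\<close> a set of symmetric matrices, so the lower bound on \<open>f\<close> is asked for on \<open>\<Omega>\<close>.
\<close>
lemma schatten_tail_global_exact_penalty: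
  fixes \<Omega> :: "(real ^ 'm ^ 'n) set"
  assumes \<Omega>: "closed \<Omega>" "rank_feasible \<Omega> r \<noteq> {}" and r: "r \<le> CARD('n)"
    and f: "bounded_below_on \<Omega> f" "coercive_on \<Omega> f" "locally_lipschitz_on \<Omega> f"
    and exact: "global_exact_penalty (\<lambda>\<rho> X. f X + ereal (\<rho> * (nuclear_norm X - ky_fan_norm r X))) \<Omega>
          f (rank_feasible \<Omega> r)"
    and p: "0 < p" "p < 1"
  shows "global_exact_penalty
            (\<lambda>\<rho> X. f X + ereal (\<rho> * (\<Sum>i = r + 1..CARD('n). singular_value i X powr p))) \<Omega>
            f (rank_feasible \<Omega> r)"
proof -
  have tail: "nuclear_norm X - ky_fan_norm r X = (\<Sum>i = r + 1..CARD('n). singular_value i X)"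
    for X :: "real ^ 'm ^ 'n"
    using sum.ub_add_nat[of 1 r "\<lambda>i. singular_value i X" "CARD('n) - r"] r
    by (simp add: nuclear_norm_def ky_fan_norm_def)
  have zero: "singular_value i X = 0" if "X \<in> rank_feasible \<Omega> r" "i \<in> {r + 1..CARD('n)}" for X i
    using that by (intro singular_value_eq_0) (auto simp: rank_feasible_def)
  show ?thesis
  proof (rule global_exact_penalty_dominate[OF _ _ _ f(1) _ _ _ exact])
    show "rank_feasible \<Omega> r \<subseteq> \<Omega>"
      by (auto simp: rank_feasible_def)
    have "closed (rank_feasible \<Omega> r)"
      using closed_Int[OF \<Omega>(1) closed_rank_le[of r]] by (simp add: rank_feasible_def Int_def)
    then show "global_solutions f (rank_feasible \<Omega> r) \<noteq> {}"
      using \<Omega>(2) f by (intro coercive_minimizer_exists) (auto simp: rank_feasible_def)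
    show "\<bar>f X\<bar> \<noteq> \<infinity>" if "X \<in> \<Omega>" for X
      using f(3) that by (simp add: locally_lipschitz_on_def)
    show "nuclear_norm X - ky_fan_norm r X = 0" if "X \<in> rank_feasible \<Omega> r" for X
      unfolding tail using zero[OF that] by (intro sum.neutral) blast
    show "(\<Sum>i = r + 1..CARD('n). singular_value i X powr p) = 0" if "X \<in> rank_feasible \<Omega> r" for X
      using zero[OF that] by (intro sum.neutral) simp
    show "nuclear_norm X - ky_fan_norm r X \<le> (\<Sum>i = r + 1..CARD('n). singular_value i X powr p)
        \<or> 1 \<le> (\<Sum>i = r + 1..CARD('n). singular_value i X powr p)" for X :: "real ^ 'm ^ 'n"
      unfolding tail using p by (intro sum_le_sum_powr singular_value_nonneg) auto
  qed
qed

theorem theorem4p2: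
  shows
    "(CARD('n::finite) \<le> CARD('m::finite) \<longrightarrow>
      (\<forall>(\<Omega> :: (real ^ 'm ^ 'n) set) (r::nat) (f :: real ^ 'm ^ 'n \<Rightarrow> ereal).
        closed \<Omega> \<and>
        r \<in> {1..CARD('n)} \<and> rank_feasible \<Omega> r \<noteq> {} \<and>
        (\<forall>X. f X \<noteq> -\<infinity>) \<and>
        bounded_below_on UNIV f \<and> coercive_on \<Omega> f \<and> locally_lipschitz_on \<Omega> f \<and>
        global_exact_penalty (\<lambda>\<rho> X. f X + ereal (\<rho> * (nuclear_norm X - ky_fan_norm r X))) \<Omega>
          f (rank_feasible \<Omega> r) \<longrightarrow>
        (\<forall>p::real. 0 < p \<and> p < 1 \<longrightarrow>
          global_exact_penalty
            (\<lambda>\<rho> X. f X + ereal (\<rho> * (\<Sum>i = r + 1..CARD('n). singular_value i X powr p))) \<Omega>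
            f (rank_feasible \<Omega> r))))
     \<and>
     (\<forall>(\<Omega> :: (real ^ 'n ^ 'n) set) (r::nat) (f :: real ^ 'n ^ 'n \<Rightarrow> ereal).
        \<Omega> \<subseteq> symmetric_matrices \<and> closed \<Omega> \<and>
        r \<in> {1..CARD('n)} \<and> rank_feasible \<Omega> r \<noteq> {} \<and>
        (\<forall>X\<in>symmetric_matrices. f X \<noteq> -\<infinity>) \<and>
        bounded_below_on symmetric_matrices f \<and> coercive_on \<Omega> f \<and> locally_lipschitz_on \<Omega> f \<and>
        global_exact_penalty (\<lambda>\<rho> X. f X + ereal (\<rho> * (nuclear_norm X - ky_fan_norm r X))) \<Omega>
          f (rank_feasible \<Omega> r) \<longrightarrow>
        (\<forall>p::real. 0 < p \<and> p < 1 \<longrightarrow>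
          global_exact_penalty
            (\<lambda>\<rho> X. f X + ereal (\<rho> * (\<Sum>i = r + 1..CARD('n). singular_value i X powr p))) \<Omega>
            f (rank_feasible \<Omega> r)))"
proof (intro conjI impI allI; elim conjE)
  fix \<Omega> :: "(real ^ 'm ^ 'n) set" and r f and p :: real
  assume \<Omega>: "closed \<Omega>" "rank_feasible \<Omega> r \<noteq> {}" and r: "r \<in> {1..CARD('n)}"
    and bounded: "bounded_below_on UNIV f"
    and f: "coercive_on \<Omega> f" "locally_lipschitz_on \<Omega> f"
    and exact: "global_exact_penalty
      (\<lambda>\<rho> X. f X + ereal (\<rho> * (nuclear_norm X - ky_fan_norm r X))) \<Omega> f (rank_feasible \<Omega> r)"
    and p: "0 < p" "p < 1"
  have "bounded_below_on \<Omega> f"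
    using bounded_below_on_subset[OF bounded subset_UNIV] .
  then show "global_exact_penalty
      (\<lambda>\<rho> X. f X + ereal (\<rho> * (\<Sum>i = r + 1..CARD('n). singular_value i X powr p))) \<Omega>
      f (rank_feasible \<Omega> r)"
    using r by (intro schatten_tail_global_exact_penalty \<Omega> f exact p) simp
next
  fix \<Omega> :: "(real ^ 'n ^ 'n) set" and r f and p :: real
  assume sym: "\<Omega> \<subseteq> symmetric_matrices" and \<Omega>: "closed \<Omega>" "rank_feasible \<Omega> r \<noteq> {}" and r: "r \<in> {1..CARD('n)}"
    and bounded: "bounded_below_on symmetric_matrices f"
    and f: "coercive_on \<Omega> f" "locally_lipschitz_on \<Omega> f"
    and exact: "global_exact_penalty
      (\<lambda>\<rho> X. f X + ereal (\<rho> * (nuclear_norm X - ky_fan_norm r X))) \<Omega> f (rank_feasible \<Omega> r)"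
    and p: "0 < p" "p < 1"
  have "bounded_below_on \<Omega> f"
    using bounded_below_on_subset[OF bounded sym] .
  then show "global_exact_penalty
      (\<lambda>\<rho> X. f X + ereal (\<rho> * (\<Sum>i = r + 1..CARD('n). singular_value i X powr p))) \<Omega>
      f (rank_feasible \<Omega> r)"
    using r by (intro schatten_tail_global_exact_penalty \<Omega> f exact p) simp
qed

end
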